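(* Let $T$ be a complete binary tree with $n$ leaves (so $n-1$ internal nodes), and let $I^*$ be the multiset of internal nodes of $T$ in which the root appears twice (so $|I^*| = n$). Let $\Pi$ be a bijection from the set of leaves of $T$ onto $I^*$, chosen uniformly at random among all $n!$ such bijections, and let $G_\Pi$ be the graph obtained from $T$ by contracting each pair $(v,\Pi(v))$, $v$ a leaf. Then, with probability $1-o(1)$ as $n\to\infty$, the node expansion of $G_\Pi$ is at least $\frac{1}{480}$; that is, every set $S$ of vertices of $G_\Pi$ with $|S|\le n/2$ satisfies $|\partial S|\ge |S|/480$.
   Context: The duplicated root is regarded as identical to the original root (in particular it has the same neighbors in $T$ as the root). The contraction of $(v,\Pi(v))$ means contracting the edge $\{v,\Pi(v)\}$ as if it existed in $T$; thus $G_\Pi$ has one vertex for each leaf $v$ of $T$ (representing the pair $\{v,\Pi(v)\}$), so $G_\Pi$ has $n$ vertices, and two such vertices are adjacent if some node of one pair is adjacent in $T$ to some node of the other pair. For an undirected graph $G=(V_G,E_G)$ and $S\subseteq V_G$, the node boundary $\partial S$ is the set of vertices not in $S$ that are adjacent to at least one vertex of $S$, and the node expansion is $h(G)=\min_{S\subseteq V_G,\ |S|\le |V_G|/2} |\partial S|/|S|$. *)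

theory Defs
  imports
    "HOL-Library.Tree"
    "HOL-Library.Multiset"
    "HOL-Library.FuncSet"
    "HOL-Library.Landau_Symbols"
    "HOL-Combinatorics.Permutations"
    "HOL-Probability.Probability"
begin

section \<open>Nodes and edges of a binary tree\<close>

text \<open>
  A node of a tree is represented by its address: the list of turns (False = left, True = right)
  on the path from the root. Following the convention of \<^theory>\<open>HOL-Library.Tree\<close>, the leaves are the
  occurrences of \<^const>\<open>Leaf\<close> and the internal nodes are the occurrences of \<^const>\<open>Node\<close>, so that
  every internal node has exactly two children; the labels stored in the tree play no role.
  For an arbitrary number of leaves, ``complete'' means that all levels but possibly the last are full,
  which is \<^const>\<open>acomplete\<close>; \<^const>\<open>complete\<close> is the special case of a perfect tree, where the
  number of leaves is a power of two.
\<close>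

fun leaf_nodes :: "'a tree \<Rightarrow> bool list set" where
  "leaf_nodes Leaf = {[]}"
| "leaf_nodes (Node l _ r) = (Cons False ` leaf_nodes l) \<union> (Cons True ` leaf_nodes r)"

fun internal_nodes :: "'a tree \<Rightarrow> bool list set" where
  "internal_nodes Leaf = {}"
| "internal_nodes (Node l _ r) =
     {[]} \<union> (Cons False ` internal_nodes l) \<union> (Cons True ` internal_nodes r)"

definition tree_nodes :: "'a tree \<Rightarrow> bool list set" where
  "tree_nodes t = leaf_nodes t \<union> internal_nodes t"

definition tree_adj :: "'a tree \<Rightarrow> bool list \<Rightarrow> bool list \<Rightarrow> bool" where
  "tree_adj t x y \<longleftrightarrow> x \<in> tree_nodes t \<and> y \<in> tree_nodes t \<and>
     (\<exists>b. y = x @ [b] \<or> x = y @ [b])"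


section \<open>Matchings of the leaves with the internal nodes\<close>

definition internal_mset :: "'a tree \<Rightarrow> bool list multiset" where
  "internal_mset t = add_mset [] (mset_set (internal_nodes t))"

text \<open>
  The distinguishable occurrences of the elements of a multiset: the copies of \<open>x\<close> are
  \<open>(x, 0), \<dots>, (x, count M x - 1)\<close>. A bijection onto a multiset is a bijection onto this set;
  the underlying element of an occurrence is its first component.
\<close>

definition occurrences :: "'b multiset \<Rightarrow> ('b \<times> nat) set" where
  "occurrences M = {(x, i). i < count M x}"

text \<open>The functions are taken extensional, so that each bijection is counted exactly once.\<close>

definition matchings :: "'a tree \<Rightarrow> (bool list \<Rightarrow> bool list \<times> nat) set" where
  "matchings t = {f \<in> leaf_nodes t \<rightarrow>\<^sub>E occurrences (internal_mset t).
                    bij_betw f (leaf_nodes t) (occurrences (internal_mset t))}"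


section \<open>The contracted graph\<close>

text \<open>
  The vertex set of the contracted graph is \<^term>\<open>leaf_nodes t\<close>, where the leaf \<open>v\<close> stands for the
  pair consisting of \<open>v\<close> and its partner. Both copies of the root have the neighbours of the root.
\<close>

definition merged_pair :: "(bool list \<Rightarrow> bool list \<times> nat) \<Rightarrow> bool list \<Rightarrow> bool list set" where
  "merged_pair f v = {v, fst (f v)}"

definition contracted_adj ::
    "'a tree \<Rightarrow> (bool list \<Rightarrow> bool list \<times> nat) \<Rightarrow> bool list \<Rightarrow> bool list \<Rightarrow> bool" where
  "contracted_adj t f v w \<longleftrightarrow>
     v \<noteq> w \<and> (\<exists>x\<in>merged_pair f v. \<exists>y\<in>merged_pair f w. tree_adj t x y)"


section \<open>Node expansion\<close>

definition node_boundary :: "'v set \<Rightarrow> ('v \<Rightarrow> 'v \<Rightarrow> bool) \<Rightarrow> 'v set \<Rightarrow> 'v set" where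
  "node_boundary V E S = {v \<in> V - S. \<exists>u\<in>S. E u v}"

text \<open>
  The minimum ranges over nonempty sets, as the quotient is meaningless for the empty set.
  It is a minimum over a finite nonempty set as soon as \<open>V\<close> is finite with at least two vertices.
\<close>

definition node_expansion :: "'v set \<Rightarrow> ('v \<Rightarrow> 'v \<Rightarrow> bool) \<Rightarrow> real" where
  "node_expansion V E =
     Min {real (card (node_boundary V E S)) / real (card S) | S.
            S \<subseteq> V \<and> S \<noteq> {} \<and> real (card S) \<le> real (card V) / 2}"


section \<open>Cardinalities\<close>

lemma finite_leaf_nodes [simp]: "finite (leaf_nodes t)"
  by (induction t) auto

lemma finite_internal_nodes [simp]: "finite (internal_nodes t)"
  by (induction t) auto

lemma card_leaf_nodes: "card (leaf_nodes t) = size1 t"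
proof (induction t)
  case (Node l x r)
  have "card (leaf_nodes (Node l x r)) =
      card (Cons False ` leaf_nodes l) + card (Cons True ` leaf_nodes r)"
    by (simp, rule card_Un_disjoint) auto
  then show ?case
    using Node by (simp add: card_image)
qed simp

lemma card_internal_nodes: "card (internal_nodes t) = size t"
proof (induction t)
  case (Node l x r)
  have "card ((Cons False ` internal_nodes l) \<union> (Cons True ` internal_nodes r)) =
      card (Cons False ` internal_nodes l) + card (Cons True ` internal_nodes r)"
    by (rule card_Un_disjoint) auto
  moreover have "[] \<notin> (Cons False ` internal_nodes l) \<union> (Cons True ` internal_nodes r)"
    by auto
  ultimately show ?case
    using Node by (simp add: card_image)
qed simp

lemma occurrences_eq_Sigma: "occurrences M = (SIGMA x:set_mset M. {..<count M x})"
  by (auto simp: occurrences_def simp flip: count_greater_zero_iff)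

lemma finite_occurrences [simp]: "finite (occurrences M)"
  by (simp add: occurrences_eq_Sigma)

lemma card_occurrences: "card (occurrences M) = size M"
  by (simp add: occurrences_eq_Sigma size_multiset_overloaded_eq)

lemma card_occurrences_internal_mset:
  "card (occurrences (internal_mset t)) = card (leaf_nodes t)"
  by (simp add: card_occurrences internal_mset_def card_internal_nodes card_leaf_nodes
      size1_size)

lemma card_extensional_bijections:
  assumes "finite A" "finite B" "card A = card B"
  shows "card {f \<in> A \<rightarrow>\<^sub>E B. bij_betw f A B} = fact (card A)"
proof -
  obtain g where g: "bij_betw g A B"
    using finite_same_card_bij assms by blast
  have "bij_betw (\<lambda>p. restrict (g \<circ> p) A) {p. p permutes A} {f \<in> A \<rightarrow>\<^sub>E B. bij_betw f A B}"
  proof (rule bij_betwI')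
    fix p q assume pq: "p \<in> {p. p permutes A}" "q \<in> {p. p permutes A}"
    show "(restrict (g \<circ> p) A = restrict (g \<circ> q) A) = (p = q)"
    proof
      assume eq: "restrict (g \<circ> p) A = restrict (g \<circ> q) A"
      show "p = q"
      proof
        fix x
        show "p x = q x"
        proof (cases "x \<in> A")
          case True
          then have "g (p x) = g (q x)"
            using fun_cong[OF eq, of x] by simp
          moreover have "p x \<in> A" "q x \<in> A"
            using True pq by (auto simp: permutes_in_image)
          ultimately show ?thesis
            using g by (auto simp: bij_betw_def dest: inj_onD)
        next
          case False
          then show ?thesis
            using pq by (simp add: permutes_not_in)
        qed
      qed
    qed simp
  next
    fix p assume "p \<in> {p. p permutes A}"
    then have "bij_betw (g \<circ> p) A B"
      using g bij_betw_trans permutes_imp_bij by blast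
    then have "bij_betw (restrict (g \<circ> p) A) A B"
      by (rule bij_betw_cong[THEN iffD1, rotated]) simp
    then show "restrict (g \<circ> p) A \<in> {f \<in> A \<rightarrow>\<^sub>E B. bij_betw f A B}"
      by (auto simp: PiE_iff dest: bij_betwE)
  next
    fix f assume f: "f \<in> {f \<in> A \<rightarrow>\<^sub>E B. bij_betw f A B}"
    define p where "p x = (if x \<in> A then inv_into A g (f x) else x)" for x
    have "bij_betw (inv_into A g \<circ> f) A A"
      using f g bij_betw_trans bij_betw_inv_into by blast
    then have "bij_betw p A A"
      by (rule bij_betw_cong[THEN iffD1, rotated]) (simp add: p_def)
    then have "p permutes A"
      by (rule bij_imp_permutes) (simp add: p_def)
    moreover have "f x = restrict (g \<circ> p) A x" for x
    proof (cases "x \<in> A")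
      case True
      then have "f x \<in> B"
        using f by auto
      then show ?thesis
        using True g by (simp add: p_def bij_betw_inv_into_right)
    next
      case False
      then show ?thesis
        using f by (auto simp: PiE_iff extensional_def)
    qed
    ultimately show "\<exists>p\<in>{p. p permutes A}. f = restrict (g \<circ> p) A"
      by blast
  qed
  then show ?thesis
    by (simp only: bij_betw_same_card[symmetric] card_permutations[OF refl assms(1)])
qed

lemma card_matchings: "card (matchings t) = fact (card (leaf_nodes t))"
  unfolding matchings_def
  by (rule card_extensional_bijections) (simp_all add: card_occurrences_internal_mset)

lemma finite_matchings [simp]: "finite (matchings t)"
  by (rule card_ge_0_finite) (simp add: card_matchings)

lemma matchings_nonempty [simp]: "matchings t \<noteq> {}"
  using card_matchings[of t] by force

end

theory Submission
  imports Defs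
begin

text \<open>
  A vertex set of the contracted graph is a set \<open>A\<close> of \<open>s\<close> leaves together with the set \<open>B\<close> of their
  \<open>s\<close> partners. If its boundary has fewer than \<open>s / 480\<close> vertices, then these cover fewer than
  \<open>s / 240\<close> nodes of the tree, and as the tree has degree at most 3, fewer than \<open>s / 80\<close> tree edges
  leave \<open>A \<union> B\<close>. A node set of a tree is determined by its cut and its membership at the root, so
  for a given \<open>s\<close> at most \<open>4 \<Sum>\<^bsub>j \<le> k\<^esub> (2n choose j)\<close> pairs \<open>(A, B)\<close> have such a small cut, where
  \<open>k = \<lfloor>s / 80\<rfloor>\<close>; one factor 2 accounts for the second copy of the root. A random matching sends \<open>A\<close>
  onto \<open>B\<close> with probability \<open>1 / (n choose s)\<close>, and the union bound gives \<open>4 / n\<^sup>2\<close> for each \<open>s\<close>. For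
  \<open>k = 0\<close> the cut is empty and there is no such pair at all.
\<close>

section \<open>Cuts of a tree\<close>

lemma tree_nodes_append1: "xs @ [b] \<in> tree_nodes t \<Longrightarrow> xs \<in> internal_nodes t"
proof (induction t arbitrary: xs)
  case Leaf
  then show ?case by (simp add: tree_nodes_def)
next
  case (Node l a r)
  then show ?case
    by (cases xs) (auto simp: tree_nodes_def)
qed

lemma leaf_internal_disjoint: "leaf_nodes t \<inter> internal_nodes t = {}"
  by (induction t) auto

lemma finite_tree_nodes: "finite (tree_nodes t)"
  by (simp add: tree_nodes_def)

lemma Nil_in_tree_nodes: "[] \<in> tree_nodes t"
  by (cases t) (auto simp: tree_nodes_def)

lemma card_nonroot_nodes_le: "card (tree_nodes t - {[]}) \<le> 2 * card (leaf_nodes t)"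
proof -
  have "card (tree_nodes t - {[]}) \<le> card (tree_nodes t)"
    by (simp add: card_mono finite_tree_nodes)
  also have "\<dots> \<le> card (leaf_nodes t) + card (internal_nodes t)"
    unfolding tree_nodes_def by (rule card_Un_le)
  finally show ?thesis
    by (simp add: card_leaf_nodes card_internal_nodes size1_size)
qed

text \<open>The edge between a node and its parent is represented by the lower node.\<close>

definition tree_cut :: "'a tree \<Rightarrow> bool list set \<Rightarrow> bool list set" where
  "tree_cut t X = {x \<in> tree_nodes t - {[]}. (x \<in> X) \<noteq> (butlast x \<in> X)}"

text \<open>Going down from the root, membership of a child follows from membership of its parent
  and from whether the edge between them is cut.\<close>

lemma tree_cut_inject:
  assumes "X \<subseteq> tree_nodes t" "Y \<subseteq> tree_nodes t"
    and root: "[] \<in> X \<longleftrightarrow> [] \<in> Y" and cut: "tree_cut t X = tree_cut t Y"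
  shows "X = Y"
proof -
  have "x \<in> tree_nodes t \<Longrightarrow> x \<in> X \<longleftrightarrow> x \<in> Y" for x
  proof (induction x rule: rev_induct)
    case Nil
    then show ?case using root by simp
  next
    case (snoc b xs)
    have "xs \<in> X \<longleftrightarrow> xs \<in> Y"
      using snoc tree_nodes_append1[of xs b t] by (auto simp: tree_nodes_def)
    moreover have "xs @ [b] \<in> tree_cut t X \<longleftrightarrow> xs @ [b] \<in> tree_cut t Y"
      using cut by simp
    ultimately show ?case
      using snoc.prems by (auto simp: tree_cut_def)
  qed
  then show ?thesis
    using assms(1,2) by blast
qed

text \<open>The empty set and the full node set also have an empty cut, so whichever of them agrees
  with \<open>X\<close> at the root equals \<open>X\<close> by
  \<open>tree_cut_inject\<close>.\<close>

lemma tree_cut_empty: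
  assumes "X \<subseteq> tree_nodes t" "tree_cut t X = {}"
  shows "X = {} \<or> X = tree_nodes t"
proof (cases "[] \<in> X")
  case True
  have "tree_cut t (tree_nodes t) = {}"
  proof -
    have "butlast x \<in> tree_nodes t" if "x \<in> tree_nodes t" "x \<noteq> []" for x
      using that tree_nodes_append1[of "butlast x" "last x" t] by (simp add: tree_nodes_def)
    then show ?thesis by (auto simp: tree_cut_def)
  qed
  then have "X = tree_nodes t"
    using assms True Nil_in_tree_nodes
    by (intro tree_cut_inject[of X t "tree_nodes t"]) auto
  then show ?thesis ..
next
  case False
  have "tree_cut t {} = {}" by (simp add: tree_cut_def)
  then have "X = {}"
    using assms False by (intro tree_cut_inject[of X t "{}"]) auto
  then show ?thesis ..
qed


section \<open>Cuts of the contracted graph\<close>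

text \<open>The second copy \<open>([], 1)\<close> of the root is ignored: membership of the root means membership of
  its first copy.\<close>

definition covered_nodes :: "bool list set \<Rightarrow> (bool list \<times> nat) set \<Rightarrow> bool list set" where
  "covered_nodes A B = A \<union> {x. (x, 0) \<in> B}"

text \<open>The pair \<open>([], 0)\<close> is listed apart because the root of a one-leaf tree is
  not internal.\<close>

lemma occurrences_internal_mset:
  "occurrences (internal_mset t) \<subseteq> insert ([], 0) (internal_nodes t \<times> {0}) \<union> {([], 1)}"
  "x \<in> internal_nodes t \<Longrightarrow> (x, 0) \<in> occurrences (internal_mset t)"
  by (auto simp: occurrences_def internal_mset_def count_mset_set' split: if_splits)

lemma occurrences_internal_mset_fst:
  "y \<in> occurrences (internal_mset t) \<Longrightarrow> fst y \<in> tree_nodes t"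
  using occurrences_internal_mset(1)[of t] Nil_in_tree_nodes[of t] by (auto simp: tree_nodes_def)

lemma covered_nodes_subset:
  assumes "A \<subseteq> leaf_nodes t" "B \<subseteq> occurrences (internal_mset t)"
  shows "covered_nodes A B \<subseteq> tree_nodes t"
  using assms occurrences_internal_mset_fst[of _ t]
  by (fastforce simp: covered_nodes_def tree_nodes_def)

text \<open>The uncovered end of a cut edge belongs to the pair of a boundary vertex. The edge,
  named by its lower node, is then that end itself or one of its two children.\<close>

lemma tree_cut_covered_nodes_subset:
  assumes f: "f \<in> matchings t" and S: "S \<subseteq> leaf_nodes t"
  shows "tree_cut t (covered_nodes S (f ` S)) \<subseteq>
    (\<Union>w \<in> node_boundary (leaf_nodes t) (contracted_adj t f) S.
      \<Union>d \<in> merged_pair f w. {d, d @ [False], d @ [True]})"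
    (is "tree_cut t ?X \<subseteq> ?R")
proof
  have bij: "bij_betw f (leaf_nodes t) (occurrences (internal_mset t))"
    using f by (simp add: matchings_def)
  have boundary: "\<exists>w \<in> node_boundary (leaf_nodes t) (contracted_adj t f) S. d \<in> merged_pair f w"
    if d: "d \<in> tree_nodes t" "d \<notin> ?X" and adj: "tree_adj t u d" and u: "u \<in> ?X" for u d
  proof -
    obtain v where v: "v \<in> S" "u \<in> merged_pair f v"
    proof (cases "u \<in> S")
      case True
      then show thesis using that[of u] by (simp add: merged_pair_def)
    next
      case False
      then obtain v where "v \<in> S" "f v = (u, 0)"
        using u by (auto simp: covered_nodes_def)
      then show thesis using that[of v] by (simp add: merged_pair_def)
    qed
    \<comment> \<open>An internal \<open>d\<close> is represented by the owner of its first copy.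
      This is the copy that \<open>covered_nodes\<close> reads, so the owner lies outside
      \<open>S\<close> even if \<open>d\<close> is the root and its second copy has its owner in
      \<open>S\<close>.\<close>
    obtain w where w: "w \<in> leaf_nodes t" "w \<notin> S" "d \<in> merged_pair f w"
    proof (cases "d \<in> leaf_nodes t")
      case True
      then show thesis
        using d that[of d] by (auto simp: covered_nodes_def merged_pair_def)
    next
      case False
      then have "(d, 0) \<in> occurrences (internal_mset t)"
        using d occurrences_internal_mset(2) by (auto simp: tree_nodes_def)
      then obtain w where w: "w \<in> leaf_nodes t" "f w = (d, 0)"
        using bij by (metis bij_betw_imp_surj_on imageE)
      moreover have "w \<notin> S"
        using d w by (force simp: covered_nodes_def)
      ultimately show thesis
        using that[of w] by (simp add: merged_pair_def)
    qed
    have "contracted_adj t f v w"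
      using v w adj by (auto simp: contracted_adj_def)
    then show ?thesis
      using v w by (auto simp: node_boundary_def)
  qed
  fix x assume x: "x \<in> tree_cut t ?X"
  then have "x \<noteq> []" by (simp add: tree_cut_def)
  then obtain p b where p: "x = p @ [b]"
    by (cases x rule: rev_exhaust) auto
  have nodes: "x \<in> tree_nodes t" "p \<in> tree_nodes t"
    using x p tree_nodes_append1[of p b t] by (auto simp: tree_cut_def tree_nodes_def)
  then have adj: "tree_adj t p x" "tree_adj t x p"
    using p by (auto simp: tree_adj_def)
  show "x \<in> ?R"
  proof (cases "x \<in> ?X")
    case True
    then have "p \<notin> ?X" using x p by (simp add: tree_cut_def)
    then obtain w where "w \<in> node_boundary (leaf_nodes t) (contracted_adj t f) S"
      "p \<in> merged_pair f w"
      using boundary True adj nodes by blast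
    then show ?thesis using p by (cases b) auto
  next
    case False
    then have "p \<in> ?X" using x p by (simp add: tree_cut_def)
    then obtain w where "w \<in> node_boundary (leaf_nodes t) (contracted_adj t f) S"
      "x \<in> merged_pair f w"
      using boundary False adj nodes by blast
    then show ?thesis by auto
  qed
qed

text \<open>The 6 is two nodes per boundary pair times at most three tree edges per node, one to the
  parent and two to the children.\<close>

lemma card_tree_cut_covered_nodes_le:
  assumes "f \<in> matchings t" "S \<subseteq> leaf_nodes t"
  shows "card (tree_cut t (covered_nodes S (f ` S))) \<le>
    6 * card (node_boundary (leaf_nodes t) (contracted_adj t f) S)"
proof -
  define D where "D = node_boundary (leaf_nodes t) (contracted_adj t f) S"
  have fin: "finite D"
    by (simp add: D_def node_boundary_def)
  have "card (tree_cut t (covered_nodes S (f ` S))) \<le>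
      card (\<Union>w \<in> D. \<Union>d \<in> merged_pair f w. {d, d @ [False], d @ [True]})"
    using tree_cut_covered_nodes_subset[OF assms] fin
    by (intro card_mono) (auto simp: merged_pair_def D_def)
  also have "\<dots> \<le> (\<Sum>w\<in>D. card (\<Union>d \<in> merged_pair f w. {d, d @ [False], d @ [True]}))"
    using fin by (rule card_UN_le)
  also have "\<dots> \<le> (\<Sum>w\<in>D. 6)"
  proof (rule sum_mono)
    fix w
    let ?xs = "concat (map (\<lambda>d. [d, d @ [False], d @ [True]]) [w, fst (f w)])"
    have "(\<Union>d \<in> merged_pair f w. {d, d @ [False], d @ [True]}) = set ?xs"
      by (auto simp: merged_pair_def)
    then show "card (\<Union>d \<in> merged_pair f w. {d, d @ [False], d @ [True]}) \<le> 6"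
      using card_length[of ?xs] by simp
  qed
  finally show ?thesis by (simp add: D_def)
qed


section \<open>Counting\<close>

text \<open>Candidates for a vertex set and its set of partners, described without a matching so
  that a union bound can range over them.\<close>

definition small_cuts ::
    "'a tree \<Rightarrow> nat \<Rightarrow> nat \<Rightarrow> (bool list set \<times> (bool list \<times> nat) set) set" where
  "small_cuts t s k = {(A, B). A \<subseteq> leaf_nodes t \<and> B \<subseteq> occurrences (internal_mset t) \<and>
     card A = s \<and> card B = s \<and> card (tree_cut t (covered_nodes A B)) \<le> k}"

lemma card_subsets_le:
  assumes "finite U"
  shows "card {C. C \<subseteq> U \<and> card C \<le> k} = (\<Sum>j\<le>k. card U choose j)"
proof -
  have "{C. C \<subseteq> U \<and> card C \<le> k} = (\<Union>j\<le>k. {C. C \<subseteq> U \<and> card C = j})"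
    by auto
  also have "card \<dots> = (\<Sum>j\<le>k. card {C. C \<subseteq> U \<and> card C = j})"
    using assms by (intro card_UN_disjoint) auto
  finally show ?thesis
    using assms by (simp add: n_subsets)
qed

text \<open>Once the root is internal, leaves and first copies of internal nodes can be read off
  separately from the covered set. Only the second copy of the root is lost, and
  \<open>extra\<close> supplies it.\<close>

lemma covered_nodes_inject:
  assumes "A \<subseteq> leaf_nodes t" "B \<subseteq> occurrences (internal_mset t)"
    and "A' \<subseteq> leaf_nodes t" "B' \<subseteq> occurrences (internal_mset t)"
    and "internal_nodes t \<noteq> {}"
    and eq: "covered_nodes A B = covered_nodes A' B'" and extra: "([], 1) \<in> B \<longleftrightarrow> ([], 1) \<in> B'"
  shows "A = A' \<and> B = B'"
proof -
  have "[] \<in> internal_nodes t"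
    using assms(5) by (cases t) auto
  then have occ: "occurrences (internal_mset t) \<subseteq> internal_nodes t \<times> {0} \<union> {([], 1)}"
    using occurrences_internal_mset(1)[of t] by auto
  have recover: "A = covered_nodes A B \<inter> leaf_nodes t \<and>
      B = (covered_nodes A B \<inter> internal_nodes t) \<times> {0} \<union> (B \<inter> {([], 1)})"
    if "A \<subseteq> leaf_nodes t" "B \<subseteq> occurrences (internal_mset t)" for A B
  proof -
    have B: "i = 0 \<and> x \<in> internal_nodes t \<or> x = [] \<and> i = 1" if "(x, i) \<in> B" for x i
      using that \<open>B \<subseteq> _\<close> occ by blast
    have A: "x \<notin> internal_nodes t" if "x \<in> A" for x
      using that \<open>A \<subseteq> _\<close> leaf_internal_disjoint[of t] by blast
    have "A = covered_nodes A B \<inter> leaf_nodes t"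
    proof -
      have "x \<in> A" if "(x, 0) \<in> B" "x \<in> leaf_nodes t" for x
        using B[OF that(1)] that(2) leaf_internal_disjoint[of t] by auto
      then show ?thesis
        using \<open>A \<subseteq> _\<close> by (auto simp: covered_nodes_def)
    qed
    moreover have "B \<subseteq> (covered_nodes A B \<inter> internal_nodes t) \<times> {0} \<union> (B \<inter> {([], 1)})"
      using B by (auto simp: covered_nodes_def)
    moreover have "(covered_nodes A B \<inter> internal_nodes t) \<times> {0} \<subseteq> B"
      using A by (auto simp: covered_nodes_def)
    ultimately show ?thesis by blast
  qed
  have "A = covered_nodes A B \<inter> leaf_nodes t" "A' = covered_nodes A' B' \<inter> leaf_nodes t"
    "B = (covered_nodes A B \<inter> internal_nodes t) \<times> {0} \<union> (B \<inter> {([], 1)})"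
    "B' = (covered_nodes A' B' \<inter> internal_nodes t) \<times> {0} \<union> (B' \<inter> {([], 1)})"
    using recover assms(1-4) by blast+
  moreover have "B \<inter> {([], 1)} = B' \<inter> {([], 1)}"
    using extra by auto
  ultimately show ?thesis
    using eq by metis
qed

lemma card_small_cuts_le:
  assumes "internal_nodes t \<noteq> {}"
  shows "card (small_cuts t s k) \<le> 4 * (\<Sum>j\<le>k. 2 * card (leaf_nodes t) choose j)"
proof -
  define U where "U = tree_nodes t - {[]}"
  \<comment> \<open>The first bit restores the second copy of the root, the second is the root
    membership needed for \<open>tree_cut_inject\<close>. Together they give the factor 4.\<close>
  define enc where "enc = (\<lambda>(A, B). (([], 1::nat) \<in> B, [] \<in> covered_nodes A B,
    tree_cut t (covered_nodes A B)))"
  have "inj_on enc (small_cuts t s k)"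
  proof (rule inj_onI, clarify)
    fix A B A' B'
    assume 1: "(A, B) \<in> small_cuts t s k" "(A', B') \<in> small_cuts t s k"
      and 2: "enc (A, B) = enc (A', B')"
    have sub: "A \<subseteq> leaf_nodes t" "B \<subseteq> occurrences (internal_mset t)"
      "A' \<subseteq> leaf_nodes t" "B' \<subseteq> occurrences (internal_mset t)"
      using 1 by (auto simp: small_cuts_def)
    moreover have "covered_nodes A B = covered_nodes A' B'"
      using sub 2
      by (intro tree_cut_inject[of "covered_nodes A B" t "covered_nodes A' B'"] covered_nodes_subset)
        (auto simp: enc_def)
    ultimately show "A = A' \<and> B = B'"
      using assms 2 by (intro covered_nodes_inject[of A t B]) (auto simp: enc_def)
  qed
  moreover have "enc ` small_cuts t s k \<subseteq> UNIV \<times> UNIV \<times> {C. C \<subseteq> U \<and> card C \<le> k}"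
    by (auto simp: enc_def small_cuts_def tree_cut_def U_def)
  moreover have finU: "finite U"
    by (simp add: U_def finite_tree_nodes)
  ultimately have "card (small_cuts t s k) \<le>
      card ((UNIV :: bool set) \<times> (UNIV :: bool set) \<times> {C. C \<subseteq> U \<and> card C \<le> k})"
    by (intro card_inj_on_le[of enc]) auto
  also have "\<dots> = 4 * (\<Sum>j\<le>k. card U choose j)"
    using finU by (simp add: card_cartesian_product card_subsets_le)
  also have "\<dots> \<le> 4 * (\<Sum>j\<le>k. 2 * card (leaf_nodes t) choose j)"
    using card_nonroot_nodes_le[of t]
    by (intro mult_left_mono sum_mono binomial_right_mono) (auto simp: U_def)
  finally show ?thesis .
qed

lemma finite_small_cuts: "finite (small_cuts t s k)"
  by (rule finite_subset[of _ "Pow (leaf_nodes t) \<times> Pow (occurrences (internal_mset t))"])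
    (auto simp: small_cuts_def)

section \<open>Bijections with a prescribed image\<close>

text \<open>Such a bijection is determined by its restrictions to \<open>A\<close> and
  \<open>L - A\<close>, which are bijections onto \<open>B\<close> and \<open>M - B\<close>.\<close>

lemma card_bijections_image_le:
  fixes L :: "'a set" and M :: "'b set"
  assumes "finite L" "finite M" "card L = card M" "A \<subseteq> L" "B \<subseteq> M" "card A = s" "card B = s"
  shows "card {f \<in> L \<rightarrow>\<^sub>E M. bij_betw f L M \<and> f ` A = B} \<le> fact s * fact (card L - s)"
proof -
  define F where "F = {f \<in> L \<rightarrow>\<^sub>E M. bij_betw f L M \<and> f ` A = B}"
  define P :: "'a set \<Rightarrow> 'b set \<Rightarrow> ('a \<Rightarrow> 'b) set"
    where "P C D = {f \<in> C \<rightarrow>\<^sub>E D. bij_betw f C D}" for C D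
  have fin: "finite A" "finite B" "finite (L - A)" "finite (M - B)"
    using assms finite_subset by auto
  have cd: "card (L - A) = card L - s" "card (M - B) = card L - s"
    using assms fin by (simp_all add: card_Diff_subset)
  have "inj_on (\<lambda>f. (restrict f A, restrict f (L - A))) F"
  proof (rule inj_onI, clarify)
    fix f g assume fg: "f \<in> F" "g \<in> F" "restrict f A = restrict g A"
      "restrict f (L - A) = restrict g (L - A)"
    show "f = g"
    proof
      fix x
      show "f x = g x"
        using fun_cong[OF fg(3), of x] fun_cong[OF fg(4), of x] fg(1,2)
        by (cases "x \<in> L"; cases "x \<in> A") (auto simp: F_def PiE_iff extensional_def)
    qed
  qed
  moreover have "(\<lambda>f. (restrict f A, restrict f (L - A))) ` F \<subseteq> P A B \<times> P (L - A) (M - B)"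
  proof clarify
    fix f assume f: "f \<in> F"
    have A: "bij_betw f A B"
      using f assms by (auto simp: F_def intro: bij_betw_subset)
    have "f ` (L - A) = M - B"
      using f assms by (auto simp: F_def bij_betw_def inj_on_image_set_diff[of f L])
    then have "bij_betw f (L - A) (M - B)"
      using f by (auto simp: F_def intro: bij_betw_subset)
    then show "restrict f A \<in> P A B \<and> restrict f (L - A) \<in> P (L - A) (M - B)"
      using A by (auto simp: P_def bij_betw_restrict_eq dest: bij_betwE)
  qed
  moreover have cards: "card (P A B) = fact s" "card (P (L - A) (M - B)) = fact (card L - s)"
    using assms fin cd by (simp_all add: P_def card_extensional_bijections)
  ultimately have "card F \<le> card (P A B \<times> P (L - A) (M - B))"
    by (intro card_inj_on_le) (auto intro: card_ge_0_finite simp: card_cartesian_product)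
  then show ?thesis
    using cards by (simp add: card_cartesian_product F_def)
qed

section \<open>Binomial estimates\<close>

text \<open>Each summand is at most \<open>x\<^sup>j / x\<^sup>k\<close> times itself, where \<open>x = k / N \<le> 1\<close>; then the
  binomial theorem bounds the sum by \<open>(1 + x)\<^sup>N / x\<^sup>k\<close>.\<close>

lemma sum_binomial_le:
  assumes "0 < k" "k \<le> N"
  shows "real (\<Sum>j\<le>k. N choose j) \<le> (exp 1 * N / k) ^ k"
proof -
  define x where "x = real k / real N"
  have x: "0 < x" "x \<le> 1" using assms by (auto simp: x_def)
  have "x ^ k * real (\<Sum>j\<le>k. N choose j) = (\<Sum>j\<le>k. real (N choose j) * x ^ k)"
    by (simp add: sum_distrib_left mult.commute)
  also have "\<dots> \<le> (\<Sum>j\<le>k. real (N choose j) * x ^ j)"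
    using x by (intro sum_mono mult_left_mono power_decreasing) auto
  also have "\<dots> \<le> (\<Sum>j\<le>N. real (N choose j) * x ^ j)"
    using x assms by (intro sum_mono2) auto
  also have "\<dots> = (x + 1) ^ N"
    by (simp add: binomial_ring)
  \<comment> \<open>Here \<open>1 + x \<le> exp x\<close>, and \<open>N * x = k\<close> turns the
    power into \<open>exp 1 ^ k\<close>.\<close>
  also have "\<dots> \<le> exp x ^ N"
    using x exp_ge_add_one_self[of x] by (intro power_mono) (auto simp: add.commute)
  also have "\<dots> = exp 1 ^ k"
    using assms by (simp add: x_def flip: exp_of_nat_mult)
  finally have "real (\<Sum>j\<le>k. N choose j) \<le> exp 1 ^ k / x ^ k"
    using x by (simp add: field_simps)
  also have "\<dots> = (exp 1 * N / k) ^ k"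
    by (simp add: x_def power_divide power_mult_distrib)
  finally show ?thesis .
qed

text \<open>With \<open>y = 80 * k / n \<le> 1 / 2\<close>, the numerator is at most
  \<open>(480 / y) ^ k\<close> and the denominator at least \<open>1 / y ^ (80 * k)\<close>. The
  quotient is thus at most \<open>(480 * y ^ 79) ^ k\<close>.\<close>

lemma sum_binomial_over_binomial_le:
  assumes k: "0 < k" "80 * k \<le> s" and s: "2 * s \<le> n"
  shows "real (\<Sum>j\<le>k. 2 * n choose j) / real (n choose s) \<le> 1 / real n ^ 2"
proof -
  define y where "y = 80 * real k / real n"
  have n: "0 < n" using assms by linarith
  have y: "0 < y" "y \<le> 1 / 2"
    using assms n by (auto simp: y_def field_simps)
  \<comment> \<open>Binomial coefficients increase up to the middle, so \<open>s\<close> may be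
    lowered to \<open>80 * k\<close>, which makes the exponent a multiple of
    \<open>k\<close>.\<close>
  have "(real n / real (80 * k)) ^ (80 * k) \<le> real (n choose (80 * k))"
    using assms by (intro binomial_ge_n_over_k_pow_k) auto
  also have "\<dots> \<le> real (n choose s)"
    using assms by (simp add: binomial_mono)
  finally have den: "1 / y ^ (80 * k) \<le> real (n choose s)"
    by (simp add: y_def power_divide)
  have "real (\<Sum>j\<le>k. 2 * n choose j) \<le> (exp 1 * real (2 * n) / real k) ^ k"
    using assms by (intro sum_binomial_le) auto
  \<comment> \<open>\<open>2 * n / k\<close> equals \<open>160 / y\<close>; then
    \<open>exp 1 \<le> 3\<close> gives 480.\<close>
  also have "\<dots> = (160 * exp 1 / y) ^ k"
    by (simp add: y_def mult_ac)
  also have "\<dots> \<le> (480 / y) ^ k"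
    using y exp_le by (intro power_mono divide_right_mono) auto
  finally have num: "real (\<Sum>j\<le>k. 2 * n choose j) \<le> (480 / y) ^ k" .
  have "real (\<Sum>j\<le>k. 2 * n choose j) / real (n choose s) \<le> (480 / y) ^ k / (1 / y ^ (80 * k))"
    using num den y by (intro frac_le) auto
  also have "\<dots> = (480 / y * y ^ 80) ^ k"
    by (simp only: power_mult_distrib power_mult divide_divide_eq_right div_by_1)
  also have "\<dots> = (480 * y ^ 79) ^ k"
  proof -
    have "480 / y * y ^ 80 = 480 * y ^ 79"
      using y by (simp add: field_simps flip: power_Suc)
    then show ?thesis by (rule arg_cong)
  qed
  \<comment> \<open>Of the 79 factors \<open>y\<close>, 77 are bounded by \<open>1 / 2\<close> and
    two are kept as \<open>6400 * (k / n) ^ 2\<close> to supply the decay in \<open>n\<close>. The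
    constant is far below the \<open>1 / 4\<close> retained here.\<close>
  also have "\<dots> \<le> ((1 / 2) ^ 2 * (real k / real n) ^ 2) ^ k"
  proof (rule power_mono)
    have "480 * y ^ 79 = 480 * (y ^ 77 * y ^ 2)"
      by (simp flip: power_add)
    also have "\<dots> \<le> 480 * ((1 / 2) ^ 77 * y ^ 2)"
      using y by (intro mult_left_mono mult_right_mono power_mono) auto
    also have "\<dots> = 480 * (1 / 2) ^ 77 * 6400 * (real k / real n) ^ 2"
      by (simp add: y_def power2_eq_square)
    also have "\<dots> \<le> (1 / 2) ^ 2 * (real k / real n) ^ 2"
      by (intro mult_right_mono) (auto simp: power_divide)
    finally show "480 * y ^ 79 \<le> (1 / 2) ^ 2 * (real k / real n) ^ 2" .
  qed (use y in auto)
  also have "\<dots> = ((1 / 2) ^ k) ^ 2 * ((real k / real n) ^ 2) ^ k"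
    by (simp only: power_mult_distrib power_mult[symmetric] mult.commute)
  \<comment> \<open>One factor \<open>(k / n) ^ 2\<close> suffices, as \<open>k / n \<le> 1\<close>.
    Its \<open>k\<close> is absorbed by the retained powers of \<open>1 / 2\<close>, since
    \<open>k < 2 ^ k\<close>.\<close>
  also have "\<dots> \<le> ((1 / 2) ^ k) ^ 2 * (real k / real n) ^ 2"
  proof -
    have "(real k / real n) ^ 2 \<le> 1"
      using assms n by (intro power_le_one) auto
    then have "((real k / real n) ^ 2) ^ k \<le> ((real k / real n) ^ 2) ^ 1"
      using k by (intro power_decreasing) auto
    then show ?thesis by (intro mult_left_mono) auto
  qed
  also have "\<dots> = (real k / 2 ^ k) ^ 2 / real n ^ 2"
    by (simp add: power_divide)
  also have "\<dots> \<le> 1 / real n ^ 2"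
    using of_nat_less_two_power[of k, where 'a = real] by (intro divide_right_mono power_le_one) auto
  finally show ?thesis .
qed

section \<open>Union bound for one set size\<close>

lemma card_matchings_with_small_cut_le:
  assumes ne: "internal_nodes t \<noteq> {}"
    and k: "0 < k" "80 * k \<le> s" and s: "2 * s \<le> card (leaf_nodes t)"
  shows "real (card {f \<in> matchings t. \<exists>A. (A, f ` A) \<in> small_cuts t s k}) \<le>
    4 / real (card (leaf_nodes t)) ^ 2 * fact (card (leaf_nodes t))"
proof -
  define n where "n = card (leaf_nodes t)"
  have "{f \<in> matchings t. \<exists>A. (A, f ` A) \<in> small_cuts t s k} \<subseteq>
    (\<Union>(A, B) \<in> small_cuts t s k. {f \<in> matchings t. f ` A = B})"
    by auto
  then have "card {f \<in> matchings t. \<exists>A. (A, f ` A) \<in> small_cuts t s k} \<le>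
      card (\<Union>(A, B) \<in> small_cuts t s k. {f \<in> matchings t. f ` A = B})"
    by (intro card_mono) (auto simp: finite_small_cuts)
  also have "\<dots> \<le> (\<Sum>(A, B) \<in> small_cuts t s k. card {f \<in> matchings t. f ` A = B})"
    using card_UN_le[OF finite_small_cuts, of "\<lambda>(A, B). {f \<in> matchings t. f ` A = B}"]
    by (simp add: case_prod_unfold)
  also have "\<dots> \<le> (\<Sum>(A, B) \<in> small_cuts t s k. fact s * fact (n - s))"
  proof (rule sum_mono, clarify)
    fix A B assume "(A, B) \<in> small_cuts t s k"
    then show "card {f \<in> matchings t. f ` A = B} \<le> fact s * fact (n - s)"
      using card_bijections_image_le[of "leaf_nodes t" "occurrences (internal_mset t)" A B s]
      by (simp add: small_cuts_def matchings_def card_occurrences_internal_mset n_def conj_assoc)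
  qed
  also have "\<dots> = card (small_cuts t s k) * (fact s * fact (n - s))"
    by simp
  also have "\<dots> \<le> 4 * (\<Sum>j\<le>k. 2 * n choose j) * (fact s * fact (n - s))"
    using card_small_cuts_le[OF ne] by (intro mult_right_mono) (auto simp: n_def)
  finally have "real (card {f \<in> matchings t. \<exists>A. (A, f ` A) \<in> small_cuts t s k}) \<le>
      real (4 * (\<Sum>j\<le>k. 2 * n choose j) * (fact s * fact (n - s)))"
    by (simp only: of_nat_le_iff)
  \<comment> \<open>\<open>fact s * fact (n - s)\<close> is \<open>fact n\<close> divided by
    \<open>n choose s\<close>.\<close>
  also have "\<dots> = 4 * (real (\<Sum>j\<le>k. 2 * n choose j) / real (n choose s)) * fact n"
  proof -
    have "real (n choose s) = fact n / (fact s * fact (n - s))"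
      using s by (intro binomial_fact) (simp add: n_def)
    then show ?thesis by simp
  qed
  also have "\<dots> \<le> 4 * (1 / real n ^ 2) * fact n"
    using k s by (intro mult_right_mono mult_left_mono sum_binomial_over_binomial_le)
      (auto simp: n_def)
  finally show ?thesis by (simp add: n_def)
qed


section \<open>Expansion\<close>

text \<open>A minimising set \<open>S\<close> of size \<open>s\<close> has fewer than
  \<open>s / 480\<close> boundary vertices, hence fewer than \<open>6 * s / 480 = s / 80\<close> cut
  edges.\<close>

lemma small_expansion_imp_small_cut:
  assumes f: "f \<in> matchings t" and n: "2 \<le> card (leaf_nodes t)"
    and small: "node_expansion (leaf_nodes t) (contracted_adj t f) < 1 / 480"
  obtains s A where "2 * s \<le> card (leaf_nodes t)" "0 < s div 80"
    "(A, f ` A) \<in> small_cuts t s (s div 80)"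
proof -
  let ?L = "leaf_nodes t" and ?D = "node_boundary (leaf_nodes t) (contracted_adj t f)"
  let ?R = "{real (card (?D S)) / real (card S) | S.
    S \<subseteq> ?L \<and> S \<noteq> {} \<and> real (card S) \<le> real (card ?L) / 2}"
  have R: "?R = (\<lambda>S. real (card (?D S)) / real (card S)) `
      {S. S \<subseteq> ?L \<and> S \<noteq> {} \<and> real (card S) \<le> real (card ?L) / 2}" (is "_ = ?r ` ?C")
    by (rule setcompr_eq_image)
  have "finite ?C"
    by (rule finite_subset[of _ "Pow ?L"]) auto
  \<comment> \<open>For at least two leaves a singleton is admissible, so the minimum is over a
    nonempty family and is attained.\<close>
  moreover obtain x where "x \<in> ?L"
    using n by fastforce
  then have "{x} \<in> ?C"
    using n by simp
  ultimately have "Min (?r ` ?C) \<in> ?r ` ?C"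
    by (intro Min_in) auto
  then obtain S where S: "S \<in> ?C" "Min (?r ` ?C) = ?r S"
    by blast
  then have "?r S < 1 / 480"
    using small unfolding node_expansion_def R by simp
  with S have S: "S \<subseteq> ?L" "S \<noteq> {}" "real (card S) \<le> real (card ?L) / 2"
    "real (card (?D S)) / real (card S) < 1 / 480"
    by auto
  define s where "s = card S"
  define X where "X = covered_nodes S (f ` S)"
  have finS: "finite S"
    using S(1) by (rule finite_subset) simp
  have s: "0 < s" "2 * s \<le> card ?L"
    using S finS by (auto simp: s_def card_gt_0_iff)
  have "480 * card (?D S) < s"
    using S s by (simp add: s_def field_simps)
  moreover have "card (tree_cut t X) \<le> 6 * card (?D S)"
    unfolding X_def using card_tree_cut_covered_nodes_le f S by blast
  ultimately have cut: "card (tree_cut t X) \<le> s div 80"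
    by linarith
  have bij: "bij_betw f ?L (occurrences (internal_mset t))"
    using f by (simp add: matchings_def)
  have fS: "f ` S \<subseteq> occurrences (internal_mset t)" "card (f ` S) = s"
    using bij S by (auto simp: bij_betw_def s_def intro!: card_image intro: inj_on_subset)
  \<comment> \<open>Otherwise the cut is empty and \<open>X\<close>, which contains the nonempty
    \<open>S\<close>, is the whole tree. A leaf outside \<open>S\<close> would then have to be a
    partner, but partners are internal nodes.\<close>
  have "0 < s div 80"
  proof (rule ccontr)
    assume "\<not> 0 < s div 80"
    then have "tree_cut t X = {}"
      using cut finite_tree_nodes[of t] by (simp add: tree_cut_def)
    then have X: "X = {} \<or> X = tree_nodes t"
      using covered_nodes_subset[OF S(1) fS(1)] by (intro tree_cut_empty) (auto simp: X_def)
    obtain l where l: "l \<in> ?L" "l \<notin> S"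
    proof -
      have "S \<noteq> ?L" using s by (auto simp: s_def)
      then show thesis using S(1) that by blast
    qed
    have "l \<in> X"
      using X l S(2) by (auto simp: X_def covered_nodes_def tree_nodes_def)
    then have "(l, 0) \<in> occurrences (internal_mset t)"
      using l fS by (auto simp: X_def covered_nodes_def)
    moreover have "[] \<notin> ?L" 
      using n by (cases t) auto
    ultimately show False
      using l occurrences_internal_mset(1)[of t] leaf_internal_disjoint[of t] by auto
  qed
  moreover have "(S, f ` S) \<in> small_cuts t s (s div 80)"
    using S fS cut by (simp add: small_cuts_def s_def X_def)
  ultimately show thesis
    using that s by blast
qed

text \<open>At most \<open>n / 2\<close> sizes \<open>s\<close> occur, each contributing a fraction
  \<open>4 / n ^ 2\<close> of all matchings.\<close>

lemma card_small_expansion_le: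
  assumes "2 \<le> card (leaf_nodes t)"
  shows "real (card {f \<in> matchings t. node_expansion (leaf_nodes t) (contracted_adj t f) < 1 / 480})
    \<le> 2 / real (card (leaf_nodes t)) * fact (card (leaf_nodes t))"
proof -
  define n where "n = card (leaf_nodes t)"
  define W where "W s = {f \<in> matchings t. \<exists>A. (A, f ` A) \<in> small_cuts t s (s div 80)}" for s
  define J where "J = {s. 2 * s \<le> n \<and> 0 < s div 80}"
  have J: "J \<subseteq> {1..n div 2}"
    by (auto simp: J_def)
  then have finJ: "finite J"
    using finite_subset by blast
  have ne: "internal_nodes t \<noteq> {}"
    using assms by (cases t) auto
  have "{f \<in> matchings t. node_expansion (leaf_nodes t) (contracted_adj t f) < 1 / 480} \<subseteq>
      (\<Union>s\<in>J. W s)"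
  proof
    fix f assume "f \<in> {f \<in> matchings t. node_expansion (leaf_nodes t) (contracted_adj t f) < 1 / 480}"
    then have f: "f \<in> matchings t"
      and small: "node_expansion (leaf_nodes t) (contracted_adj t f) < 1 / 480"
      by auto
    obtain s A where "2 * s \<le> card (leaf_nodes t)" "0 < s div 80"
      "(A, f ` A) \<in> small_cuts t s (s div 80)"
      by (rule small_expansion_imp_small_cut[OF f assms small])
    then show "f \<in> (\<Union>s\<in>J. W s)"
      using f by (auto simp: J_def W_def n_def)
  qed
  then have "card {f \<in> matchings t. node_expansion (leaf_nodes t) (contracted_adj t f) < 1 / 480} \<le>
      card (\<Union>s\<in>J. W s)"
    using finJ by (intro card_mono) (auto simp: W_def)
  also have "\<dots> \<le> (\<Sum>s\<in>J. card (W s))"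
    using finJ by (rule card_UN_le)
  finally have "real (card {f \<in> matchings t. node_expansion (leaf_nodes t) (contracted_adj t f) < 1 / 480})
      \<le> (\<Sum>s\<in>J. real (card (W s)))"
    by (simp flip: of_nat_sum)
  also have "\<dots> \<le> (\<Sum>s\<in>J. 4 / real n ^ 2 * fact n)"
    unfolding W_def n_def using ne
    by (intro sum_mono card_matchings_with_small_cut_le) (auto simp: J_def n_def)
  also have "\<dots> = real (card J) * (4 / real n ^ 2 * fact n)"
    by simp
  also have "\<dots> \<le> real n / 2 * (4 / real n ^ 2 * fact n)"
  proof (rule mult_right_mono)
    have "card J \<le> n div 2"
      using card_mono[OF _ J] by simp
    then show "real (card J) \<le> real n / 2" by linarith
  qed simp
  also have "\<dots> = 2 / real n * fact n"
    using assms by (simp add: n_def power2_eq_square)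
  finally show ?thesis by (simp add: n_def)
qed

theorem theorem1:
  "\<exists>\<delta> :: nat \<Rightarrow> real. \<delta> \<in> o(\<lambda>_. 1) \<and>
     (\<forall>(n :: nat) (T :: 'a tree). acomplete T \<and> card (leaf_nodes T) = n \<longrightarrow>
        measure_pmf.prob (pmf_of_set (matchings T))
          {f. node_expansion (leaf_nodes T) (contracted_adj T f) \<ge> 1 / 480} \<ge> 1 - \<delta> n)"
proof (intro exI[of _ "\<lambda>n. 2 / real n"] conjI allI impI)
  show "(\<lambda>n. 2 / real n) \<in> o(\<lambda>_. 1)"
    by (rule smalloI_tendsto) (auto intro: lim_const_over_n)
next
  fix n and T :: "'a tree"
  assume "acomplete T \<and> card (leaf_nodes T) = n"
  then have n: "card (leaf_nodes T) = n" by simp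
  let ?good = "{f. node_expansion (leaf_nodes T) (contracted_adj T f) \<ge> 1 / 480}"
  show "measure_pmf.prob (pmf_of_set (matchings T)) ?good \<ge> 1 - 2 / real n"
  proof (cases "2 \<le> n")
    case True
    have "measure_pmf.prob (pmf_of_set (matchings T)) (- ?good) =
        real (card (matchings T \<inter> - ?good)) / fact n"
      by (simp add: measure_pmf_of_set card_matchings n)
    also have "matchings T \<inter> - ?good =
        {f \<in> matchings T. node_expansion (leaf_nodes T) (contracted_adj T f) < 1 / 480}"
      by auto
    also have "real (card \<dots>) / fact n \<le> 2 / real n"
      using card_small_expansion_le[of T] True by (simp add: n divide_le_eq)
    finally show ?thesis
      using measure_pmf.prob_compl[of ?good "pmf_of_set (matchings T)"]
      by (simp add: Compl_eq_Diff_UNIV)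
  next
    case False
    \<comment> \<open>For a single leaf no set is admissible and the expansion is an unspecified
      \<open>Min\<close> of the empty set, but the claimed lower bound is negative.\<close>
    have "n \<noteq> 0"
      using n by (simp add: card_leaf_nodes size1_size flip: n)
    then have "n = 1" using False by simp
    then have "1 - 2 / real n \<le> 0" by simp
    then show ?thesis
      using measure_nonneg order_trans by blast
  qed
qed

end
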